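(* Let $(V,E,<)$ be a nonempty wellordered connected graph with algorithmic traversal $\prec$ and traversal least neighbor function $p^\star$. Suppose that $P$ is a partition of $(V,\prec)$ into ($\prec$-)intervals, and suppose that every member $W_i\in P$ induces a connected subgraph of $(V,E)$ and is closed under $p^\star$, except for possibly at its $\prec$-least element $w_i$. Order $P$ by setting $W_i<W_j$ just in case $w_i<w_j$, and make it into a (connected) graph by putting an edge between $W_i$ and $W_j$ (distinct) in case there is an edge between some element of $W_i$ and some element of $W_j$ in the original graph $(V,E)$. Let $(P,\triangleleft)$ be the algorithmic traversal order of this wellordered graph. Then $W_i\triangleleft W_j$ if and only if $w_i\prec w_j$.
   Context: A wellordered connected graph $(V,E,<)$ is a connected undirected graph $(V,E)$ (possibly infinite) together with a wellordering $<$ of $V$. Deterministic graph search on $(V,E,<)$ defines sets $S_\alpha\subseteq V$ by transfinite recursion: $S_0=\emptyset$; $S_1=\{v_0\}$, where $v_0$ is the $<$-least element of $V$; for $\beta\ge 1$, $S_{\beta+1}$ is obtained from $S_\beta$ by adding the $<$-least element of $\{v\in V\setminus S_\beta:\exists w\in S_\beta\ E(w,v)\}$ if this set is nonempty, and $S_{\beta+1}=S_\beta$ otherwise; and $S_\alpha=\bigcup_{\beta<\alpha}S_\beta$ at limit $\alpha$. Every vertex eventually enters some $S_\alpha$. The algorithmic traversal is the wellordering $\prec$ of $V$ given by $v\prec w$ iff the least $\alpha$ with $v\in S_\alpha$ is less than the least $\alpha$ with $w\in S_\alpha$. The traversal least neighbor function $p^\star$ takes each vertex other than the least element of $V$ to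 its $\prec$-least neighbor, and is undefined on the least element. A set $W$ is closed under $p^\star$ except possibly at $w\in W$ if $p^\star(u)\in W$ for all $u\in W\setminus\{w\}$. *)

theory Defs
  imports "HOL-Library.Disjoint_Sets"
begin

text \<open>
  A graph is a vertex set \<open>V\<close> with a symmetric edge relation \<open>E\<close>; loops are not excluded.
  Wellorderings are the reflexive ones of the library (\<open>well_order_on\<close>), so the strict order
  of the text is \<open>r - Id\<close>, and the least element of \<open>A\<close> is \<open>wo_rel.minim r A\<close>.
\<close>

definition induces_connected :: "'a rel \<Rightarrow> 'a set \<Rightarrow> bool" where
  "induces_connected E W \<longleftrightarrow> (\<forall>u\<in>W. \<forall>v\<in>W. (u, v) \<in> (E \<inter> W \<times> W)\<^sup>*)"

definition wellordered_connected_graph :: "'a set \<Rightarrow> 'a rel \<Rightarrow> 'a rel \<Rightarrow> bool" where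
  "wellordered_connected_graph V E r \<longleftrightarrow>
     E \<subseteq> V \<times> V \<and> sym E \<and> induces_connected E V \<and> well_order_on V r"

text \<open>
  HOL has no type of all ordinals. The stages of the search are defined over an arbitrary
  wellordered type \<open>'o\<close>. For vertices in \<open>'a\<close> the search is then run along the type
  \<open>'a search_ord\<close>, whose order type is an infinite cardinal greater than the cardinality
  of \<open>'a\<close>: it is a limit ordinal, and every vertex is reached along it
  (lemma \<open>search_exhausts\<close> below).
\<close>

typedef 'a search_ord = "UNIV :: ('a + nat) set set" ..

instantiation search_ord :: (type) wellorder
begin

definition less_eq_search_ord :: "'a search_ord \<Rightarrow> 'a search_ord \<Rightarrow> bool" where
  "(\<alpha> :: 'a search_ord) \<le> \<beta> \<longleftrightarrow>
     (Rep_search_ord \<alpha>, Rep_search_ord \<beta>) \<in> card_of (UNIV :: ('a + nat) set set)"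

definition less_search_ord :: "'a search_ord \<Rightarrow> 'a search_ord \<Rightarrow> bool" where
  "(\<alpha> :: 'a search_ord) < \<beta> \<longleftrightarrow> \<alpha> \<le> \<beta> \<and> \<alpha> \<noteq> \<beta>"

instance
proof -
  let ?r = "card_of (UNIV :: ('a + nat) set set)"
  have wo: "well_order_on UNIV ?r" by (rule card_of_well_order_on)
  have refl: "\<And>x. (x, x) \<in> ?r" and tr: "trans ?r" and as: "antisym ?r"
    and tot: "total_on UNIV ?r" and wf: "wf (?r - Id)"
    using wo by (auto simp: order_on_defs refl_on_def)
  show "OFCLASS('a search_ord, wellorder_class)"
  proof
    fix x y z :: "'a search_ord"
    show "x \<le> x" by (simp add: less_eq_search_ord_def refl)
    show "x \<le> y \<Longrightarrow> y \<le> z \<Longrightarrow> x \<le> z"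
      unfolding less_eq_search_ord_def by (rule transD[OF tr])
    show as': "x \<le> y \<Longrightarrow> y \<le> x \<Longrightarrow> x = y"
      unfolding less_eq_search_ord_def
      using antisymD[OF as, of "Rep_search_ord x" "Rep_search_ord y"] by (simp add: Rep_search_ord_inject)
    show "(x < y) = (x \<le> y \<and> \<not> y \<le> x)"
      unfolding less_search_ord_def less_eq_search_ord_def
      using antisymD[OF as, of "Rep_search_ord x" "Rep_search_ord y"] refl
      by (auto simp: Rep_search_ord_inject)
    show "x \<le> y \<or> y \<le> x"
      unfolding less_eq_search_ord_def using tot refl unfolding total_on_def by (cases "Rep_search_ord x = Rep_search_ord y") auto
  next
    fix P :: "'a search_ord \<Rightarrow> bool" and a
    assume step: "\<And>x. (\<And>y. y < x \<Longrightarrow> P y) \<Longrightarrow> P x"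
    have "wf {(x, y :: 'a search_ord). x < y}"
      by (rule wf_subset[OF wf_inv_image[OF wf, of Rep_search_ord]])
        (auto simp: less_search_ord_def less_eq_search_ord_def Rep_search_ord_inject)
    then show "P a" by (rule wf_induct_rule) (use step in blast)
  qed
qed

end

definition is_zero :: "'o::wellorder \<Rightarrow> bool" where
  "is_zero \<alpha> \<longleftrightarrow> (\<forall>\<beta>. \<alpha> \<le> \<beta>)"

definition is_succ :: "'o::wellorder \<Rightarrow> 'o \<Rightarrow> bool" where
  "is_succ \<beta> \<alpha> \<longleftrightarrow> \<beta> < \<alpha> \<and> (\<nexists>\<gamma>. \<beta> < \<gamma> \<and> \<gamma> < \<alpha>)"

definition is_limit :: "'o::wellorder \<Rightarrow> bool" where
  "is_limit \<alpha> \<longleftrightarrow> \<not> is_zero \<alpha> \<and> (\<nexists>\<beta>. is_succ \<beta> \<alpha>)"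

lemma is_succ_inj: "is_succ \<beta> \<alpha> \<Longrightarrow> is_succ \<beta>' \<alpha> \<Longrightarrow> \<beta> = \<beta>'"
  unfolding is_succ_def by (meson linorder_neqE)

lemma the_is_succ: "is_succ \<beta> \<alpha> \<Longrightarrow> (THE \<beta>. is_succ \<beta> \<alpha>) = \<beta>"
  using is_succ_inj by blast

definition boundary :: "'a set \<Rightarrow> 'a rel \<Rightarrow> 'a set \<Rightarrow> 'a set" where
  "boundary V E S = {v \<in> V - S. \<exists>w\<in>S. (w, v) \<in> E}"

definition search_step :: "'a set \<Rightarrow> 'a rel \<Rightarrow> 'a rel \<Rightarrow> 'a set \<Rightarrow> 'a set" where
  "search_step V E r S =
     (if boundary V E S = {} then S else insert (wo_rel.minim r (boundary V E S)) S)"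

text \<open>
  The four clauses of the transfinite recursion are stated separately in
  \<open>search_stage_zero\<close>, \<open>search_stage_one\<close>, \<open>search_stage_succ\<close>, \<open>search_stage_limit\<close>.
\<close>

function search_stage :: "'a set \<Rightarrow> 'a rel \<Rightarrow> 'a rel \<Rightarrow> 'o::wellorder \<Rightarrow> 'a set" where
  "search_stage V E r \<alpha> =
     (if is_zero \<alpha> then {}
      else if \<exists>\<beta>. is_succ \<beta> \<alpha> then
        (let \<beta> = (THE \<beta>. is_succ \<beta> \<alpha>) in
         if is_zero \<beta> then {wo_rel.minim r V}
         else search_step V E r (search_stage V E r \<beta>))
      else (\<Union>\<beta>\<in>{..<\<alpha>}. search_stage V E r \<beta>))"
  by pat_completeness auto
termination
proof (relation "inv_image {(x :: 'o :: wellorder, y). x < y} (\<lambda>(V, E, r, \<alpha>). \<alpha>)", goal_cases)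
  case 1
  show ?case by (intro wf_inv_image wf)
next
  case (2 V E r \<alpha> \<beta>)
  then show ?case by (auto simp: the_is_succ) (auto simp: is_succ_def)
next
  case 3
  then show ?case by simp
qed

declare search_stage.simps [simp del]

lemma search_stage_zero: "is_zero \<alpha> \<Longrightarrow> search_stage V E r \<alpha> = {}"
  by (simp add: search_stage.simps)

lemma is_succ_not_zero: "is_succ \<beta> \<alpha> \<Longrightarrow> \<not> is_zero \<alpha>"
  by (auto simp: is_succ_def is_zero_def not_le)

lemma search_stage_one:
  "is_zero \<beta> \<Longrightarrow> is_succ \<beta> \<alpha> \<Longrightarrow> search_stage V E r \<alpha> = {wo_rel.minim r V}"
  by (subst search_stage.simps) (auto simp: the_is_succ Let_def dest: is_succ_not_zero)

lemma search_stage_succ: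
  "\<not> is_zero \<beta> \<Longrightarrow> is_succ \<beta> \<alpha> \<Longrightarrow>
     search_stage V E r \<alpha> = search_step V E r (search_stage V E r \<beta>)"
  by (subst search_stage.simps) (auto simp: the_is_succ Let_def dest: is_succ_not_zero)

lemma search_stage_limit:
  "is_limit \<alpha> \<Longrightarrow> search_stage V E r \<alpha> = (\<Union>\<beta><\<alpha>. search_stage V E r \<beta>)"
  by (subst search_stage.simps) (auto simp: is_limit_def)

definition entry_time :: "'a set \<Rightarrow> 'a rel \<Rightarrow> 'a rel \<Rightarrow> 'a \<Rightarrow> 'a search_ord" where
  "entry_time V E r v = (LEAST \<alpha>. v \<in> search_stage V E r \<alpha>)"

definition traversal_less :: "'a set \<Rightarrow> 'a rel \<Rightarrow> 'a rel \<Rightarrow> 'a \<Rightarrow> 'a \<Rightarrow> bool" where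
  "traversal_less V E r v w \<longleftrightarrow>
     v \<in> V \<and> w \<in> V \<and> entry_time V E r v < entry_time V E r w"

text \<open>Reflexive version of \<open>traversal_less\<close>; a wellordering by \<open>well_order_on_traversal\<close>.\<close>

definition traversal :: "'a set \<Rightarrow> 'a rel \<Rightarrow> 'a rel \<Rightarrow> 'a rel" where
  "traversal V E r =
     {(v, w). v \<in> V \<and> w \<in> V \<and> (v = w \<or> traversal_less V E r v w)}"

definition traversal_least :: "'a set \<Rightarrow> 'a rel \<Rightarrow> 'a rel \<Rightarrow> 'a set \<Rightarrow> 'a" where
  "traversal_least V E r W = wo_rel.minim (traversal V E r) W"

definition traversal_least_neighbor ::
    "'a set \<Rightarrow> 'a rel \<Rightarrow> 'a rel \<Rightarrow> 'a \<Rightarrow> 'a option" where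
  "traversal_least_neighbor V E r v =
     (if v \<in> V \<and> v \<noteq> wo_rel.minim r V
      then Some (traversal_least V E r {w \<in> V. (v, w) \<in> E})
      else None)"

definition closed_except :: "('a \<Rightarrow> 'a option) \<Rightarrow> 'a set \<Rightarrow> 'a \<Rightarrow> bool" where
  "closed_except p W w \<longleftrightarrow> w \<in> W \<and> (\<forall>u\<in>W - {w}. \<exists>x\<in>W. p u = Some x)"

definition order_interval :: "'a rel \<Rightarrow> 'a set \<Rightarrow> bool" where
  "order_interval r W \<longleftrightarrow>
     (\<forall>x\<in>W. \<forall>z\<in>W. \<forall>y. (x, y) \<in> r \<and> (y, z) \<in> r \<longrightarrow> y \<in> W)"

definition quotient_edges :: "'a rel \<Rightarrow> 'a set set \<Rightarrow> 'a set rel" where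
  "quotient_edges E P =
     {(A, B). A \<in> P \<and> B \<in> P \<and> A \<noteq> B \<and> (\<exists>a\<in>A. \<exists>b\<in>B. (a, b) \<in> E)}"

text \<open>
  As \<open>r\<close> is reflexive, so is this order. Parts are compared by \<open>r\<close> on their representatives \<open>f A\<close>; this will be used with \<open>f A\<close>
  the traversal-least element of \<open>A\<close>.
\<close>

definition quotient_order :: "'a rel \<Rightarrow> ('a set \<Rightarrow> 'a) \<Rightarrow> 'a set set \<Rightarrow> 'a set rel" where
  "quotient_order r f P = {(A, B). A \<in> P \<and> B \<in> P \<and> (f A, f B) \<in> r}"

lemma wo_relI: "well_order_on V r \<Longrightarrow> wo_rel r"
  using well_order_on_Well_order unfolding wo_rel_def by blast

lemma minim_on_in: "well_order_on V r \<Longrightarrow> A \<subseteq> V \<Longrightarrow> A \<noteq> {} \<Longrightarrow> wo_rel.minim r A \<in> A"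
  by (metis wo_relI wo_rel.minim_in well_order_on_Field)

lemma search_ord_ex_succ: "\<exists>\<alpha>. is_succ (\<beta> :: 'a search_ord) \<alpha>"
proof -
  let ?r = "card_of (UNIV :: ('a + nat) set set)"
  have "infinite (UNIV :: ('a + nat) set set)"
    by (simp add: Finite_Set.finite_set)
  then have "\<exists>b\<in>Field ?r. Rep_search_ord \<beta> \<noteq> b \<and> (Rep_search_ord \<beta>, b) \<in> ?r"
    by (intro infinite_Card_order_limit[OF card_of_Card_order]) (simp_all add: Field_card_of)
  then obtain b where b: "Rep_search_ord \<beta> \<noteq> b" "(Rep_search_ord \<beta>, b) \<in> ?r" by blast
  have gt: "\<beta> < Abs_search_ord b"
    using b by (auto simp: less_search_ord_def less_eq_search_ord_def Abs_search_ord_inverse)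
  have "is_succ \<beta> (LEAST \<alpha>. \<beta> < \<alpha>)"
    unfolding is_succ_def using LeastI[of "\<lambda>\<alpha>. \<beta> < \<alpha>", OF gt] not_less_Least by blast
  then show ?thesis ..
qed

lemma ordinal_cases:
  obtains "is_zero \<alpha>" | \<beta> where "is_succ \<beta> \<alpha>" | "is_limit \<alpha>"
  by (auto simp: is_limit_def)

lemma search_stage_step_mono:
  assumes "is_succ \<beta> \<alpha>" shows "search_stage V E r \<beta> \<subseteq> search_stage V E r \<alpha>"
proof (cases "is_zero \<beta>")
  case False
  show ?thesis by (auto simp: search_stage_succ[OF False assms] search_step_def)
qed (simp add: search_stage_zero)

lemma search_stage_mono:
  "\<beta> \<le> \<alpha> \<Longrightarrow> search_stage V E r \<beta> \<subseteq> search_stage V E r \<alpha>"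
proof (induction \<alpha> rule: less_induct)
  case (less \<alpha>)
  show ?case
  proof (cases "\<beta> = \<alpha>")
    case False
    then have lt: "\<beta> < \<alpha>" using less.prems by simp
    show ?thesis
    proof (cases \<alpha> rule: ordinal_cases)
      case 1
      then show ?thesis using lt by (auto simp: is_zero_def leD)
    next
      case (2 \<gamma>)
      then have "\<beta> \<le> \<gamma>" "\<gamma> < \<alpha>" using lt by (auto simp: is_succ_def not_less)
      then have "search_stage V E r \<beta> \<subseteq> search_stage V E r \<gamma>" by (intro less.IH)
      then show ?thesis using search_stage_step_mono[OF 2] by (rule order_trans)
    next
      case 3
      then show ?thesis using lt by (auto simp: search_stage_limit)
    qed
  qed simp
qed

lemma search_stage_subset:
  assumes wo: "well_order_on V r" and ne: "V \<noteq> {}"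
  shows "search_stage V E r \<alpha> \<subseteq> V"
proof (induction \<alpha> rule: less_induct)
  case (less \<alpha>)
  show ?case
  proof (cases \<alpha> rule: ordinal_cases)
    case 1 then show ?thesis by (simp add: search_stage_zero)
  next
    case (2 \<beta>)
    have IH: "search_stage V E r \<beta> \<subseteq> V" using 2 less by (simp add: is_succ_def)
    show ?thesis
    proof (cases "is_zero \<beta>")
      case True
      then show ?thesis using 2 minim_on_in[OF wo subset_refl ne] by (simp add: search_stage_one)
    next
      case False
      have "boundary V E (search_stage V E r \<beta>) \<noteq> {} \<Longrightarrow>
          wo_rel.minim r (boundary V E (search_stage V E r \<beta>)) \<in> V"
        using minim_on_in[OF wo, of "boundary V E (search_stage V E r \<beta>)"]
        by (auto simp: boundary_def)
      then show ?thesis using IH by (auto simp: search_stage_succ[OF False 2] search_step_def)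
    qed
  next
    case 3 then show ?thesis using less by (auto simp: search_stage_limit)
  qed
qed

lemma boundary_nonempty:
  assumes conn: "induces_connected E V" and S: "S \<subseteq> V" "a \<in> S" and v: "v \<in> V" "v \<notin> S"
  shows "boundary V E S \<noteq> {}"
proof
  assume emp: "boundary V E S = {}"
  have "(a, v) \<in> (E \<inter> V \<times> V)\<^sup>*" using conn S v by (auto simp: induces_connected_def)
  then have "v \<in> S"
  proof (induction rule: rtrancl_induct)
    case base then show ?case using S by simp
  next
    case (step y z) then show ?case using emp by (auto simp: boundary_def)
  qed
  then show False using v by simp
qed

lemma search_exhausts:
  assumes G: "wellordered_connected_graph V E r" and v: "v \<in> V"
  shows "\<exists>\<alpha> :: 'a search_ord. (v :: 'a) \<in> search_stage V E r \<alpha>"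
proof (rule ccontr)
  assume nv: "\<not> ?thesis"
  have wo: "well_order_on V r" and conn: "induces_connected E V"
    using G by (auto simp: wellordered_connected_graph_def)
  have ne: "V \<noteq> {}" using v by auto
  let ?S = "search_stage V E r :: 'a search_ord \<Rightarrow> 'a set"
  have grow: "?S \<beta> \<subset> ?S \<alpha>" if s: "is_succ \<beta> \<alpha>" for \<alpha> \<beta>
  proof (cases "is_zero \<beta>")
    case True
    then show ?thesis using s by (auto simp: search_stage_zero search_stage_one)
  next
    case False
    define \<zeta> :: "'a search_ord" where "\<zeta> = (LEAST x. True)"
    have z: "is_zero \<zeta>" unfolding is_zero_def \<zeta>_def by (intro allI Least_le TrueI)
    obtain \<iota> where i: "is_succ \<zeta> \<iota>" using search_ord_ex_succ by blast
    have "\<zeta> < \<beta>" using False z unfolding is_zero_def by (metis order_le_less)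
    then have "\<iota> \<le> \<beta>" using i unfolding is_succ_def by (meson not_less)
    then have "?S \<iota> \<subseteq> ?S \<beta>" by (rule search_stage_mono)
    then have m: "wo_rel.minim r V \<in> ?S \<beta>" by (simp add: search_stage_one[OF z i])
    have "v \<notin> ?S \<beta>" using nv by simp
    then have b: "boundary V E (?S \<beta>) \<noteq> {}"
      by (rule boundary_nonempty[OF conn search_stage_subset[OF wo ne] m v])
    have "wo_rel.minim r (boundary V E (?S \<beta>)) \<in> boundary V E (?S \<beta>)"
      by (rule minim_on_in[OF wo _ b]) (auto simp: boundary_def)
    then show ?thesis
      using b by (auto simp: search_stage_succ[OF False s] search_step_def boundary_def)
  qed
  define nxt where "nxt \<beta> = (SOME \<alpha> :: 'a search_ord. is_succ \<beta> \<alpha>)" for \<beta>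
  have nxt: "is_succ \<beta> (nxt \<beta>)" for \<beta>
    unfolding nxt_def by (rule someI_ex[OF search_ord_ex_succ])
  define f where "f \<beta> = (SOME x. x \<in> ?S (nxt \<beta>) - ?S \<beta>)" for \<beta>
  have f: "f \<beta> \<in> ?S (nxt \<beta>) - ?S \<beta>" for \<beta>
  proof -
    have "\<exists>x. x \<in> ?S (nxt \<beta>) - ?S \<beta>" using psubset_imp_ex_mem[OF grow[OF nxt]] .
    then show ?thesis unfolding f_def by (rule someI_ex)
  qed
  have f_lt: "f \<beta> \<noteq> f \<gamma>" if "\<beta> < \<gamma>" for \<beta> \<gamma>
  proof -
    have "nxt \<beta> \<le> \<gamma>" using nxt[of \<beta>] that unfolding is_succ_def by (meson not_less)
    then have "?S (nxt \<beta>) \<subseteq> ?S \<gamma>" by (rule search_stage_mono)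
    then show ?thesis using f[of \<beta>] f[of \<gamma>] by (metis DiffE subsetD)
  qed
  then have "inj f" by (metis injI linorder_neqE)
  define h :: "('a + nat) set \<Rightarrow> 'a + nat" where "h A = Inl (f (Abs_search_ord A))" for A
  have "inj h"
  proof (rule injI)
    fix A B assume "h A = h B"
    then have "Abs_search_ord A = Abs_search_ord B"
      using injD[OF \<open>inj f\<close>] by (simp add: h_def)
    then show "A = B" by (simp add: Abs_search_ord_inject)
  qed
  then have "range (inv h) = Pow UNIV" using inj_imp_surj_inv by auto
  then show False using Cantors_theorem by blast
qed

lemma entry_time_inject:
  assumes G: "wellordered_connected_graph V E r" and vw: "v \<in> V" "w \<in> V"
    and eq: "entry_time V E r v = entry_time V E r w"
  shows "v = w"
proof -
  let ?S = "search_stage V E r :: 'a search_ord \<Rightarrow> 'a set"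
  define \<alpha> where "\<alpha> = entry_time V E r v"
  have mem: "v \<in> ?S \<alpha>" "w \<in> ?S \<alpha>"
    using search_exhausts[OF G] vw eq unfolding \<alpha>_def entry_time_def by (metis LeastI)+
  have nmem: "v \<notin> ?S \<beta>" "w \<notin> ?S \<beta>" if "\<beta> < \<alpha>" for \<beta>
    using that eq unfolding \<alpha>_def entry_time_def by (metis not_less_Least)+
  show ?thesis
  proof (cases \<alpha> rule: ordinal_cases)
    case 1 then show ?thesis using mem by (simp add: search_stage_zero)
  next
    case (2 \<beta>)
    then have nb: "v \<notin> ?S \<beta>" "w \<notin> ?S \<beta>" using nmem by (auto simp: is_succ_def)
    show ?thesis
    proof (cases "is_zero \<beta>")
      case True then show ?thesis using mem 2 by (simp add: search_stage_one)
    next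
      case False
      then show ?thesis using mem nb
        by (auto simp: search_stage_succ[OF False 2] search_step_def split: if_splits)
    qed
  next
    case 3 then show ?thesis using mem nmem by (auto simp: search_stage_limit)
  qed
qed

lemma well_order_on_traversal:
  assumes G: "wellordered_connected_graph V E r"
  shows "well_order_on V (traversal V E r)"
proof -
  have "traversal V E r - Id \<subseteq> inv_image {(x, y). x < y} (entry_time V E r)"
    by (auto simp: traversal_def traversal_less_def)
  then have "wf (traversal V E r - Id)"
    using wf_subset[OF wf_inv_image[OF wf]] by blast
  moreover have "trans (traversal V E r)" "antisym (traversal V E r)"
    by (auto simp: traversal_def traversal_less_def trans_def antisym_def)
  moreover have "total_on V (traversal V E r)"
    using entry_time_inject[OF G]
    by (auto simp: total_on_def traversal_def traversal_less_def) (meson linorder_neqE)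
  ultimately show ?thesis
    by (auto simp: order_on_defs refl_on_def traversal_def)
qed

lemma wellordered_connected_graph_quotient:
  fixes V :: "'a set"
  assumes G: "wellordered_connected_graph V E r" and P: "partition_on V P"
  defines "least \<equiv> traversal_least V E r"
  shows "wellordered_connected_graph P (quotient_edges E P) (quotient_order r least P)"
proof -
  have wo: "well_order_on V r" and conn: "induces_connected E V" and sy: "sym E"
    using G by (auto simp: wellordered_connected_graph_def)
  have least: "least A \<in> A" if "A \<in> P" for A
    unfolding least_def traversal_least_def
    by (rule minim_on_in[OF well_order_on_traversal[OF G]])
      (use P that in \<open>auto simp: partition_on_def\<close>)
  have disj: "A = B" if "A \<in> P" "B \<in> P" "x \<in> A" "x \<in> B" for A B x
    using P that by (auto simp: partition_on_def disjoint_def)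
  have inV: "least A \<in> V" if "A \<in> P" for A
    using least[OF that] that P by (auto simp: partition_on_def)
  have inj: "A = B" if "A \<in> P" "B \<in> P" "least A = least B" for A B
    using disj[OF that(1,2)] least that by metis
  let ?r = "quotient_order r least P"
  have r: "trans r" "antisym r" "total_on V r" "\<And>x. x \<in> V \<Longrightarrow> (x, x) \<in> r" "wf (r - Id)"
    using wo by (auto simp: order_on_defs refl_on_def)
  have "?r - Id \<subseteq> inv_image (r - Id) least"
    using inj unfolding quotient_order_def inv_image_def by blast
  then have "wf (?r - Id)" using wf_subset[OF wf_inv_image[OF r(5)]] by blast
  moreover have "trans ?r" using r(1) unfolding quotient_order_def trans_def by blast
  moreover have "antisym ?r"
    using r(2) inj unfolding quotient_order_def antisym_def by blast
  moreover have "total_on P ?r"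
    using r(3) inj inV unfolding quotient_order_def total_on_def by blast
  moreover have "refl_on P ?r" using r(4) inV by (auto simp: quotient_order_def refl_on_def)
  ultimately have "well_order_on P ?r" by (auto simp: order_on_defs quotient_order_def)
  moreover have "sym (quotient_edges E P)"
    using sy unfolding sym_def quotient_edges_def by blast
  moreover have sub: "quotient_edges E P \<subseteq> P \<times> P" by (auto simp: quotient_edges_def)
  moreover have "induces_connected (quotient_edges E P) P"
    unfolding induces_connected_def
  proof (intro ballI)
    fix A B assume A: "A \<in> P" and B: "B \<in> P"
    have path: "\<forall>C\<in>P. z \<in> C \<longrightarrow> (A, C) \<in> (quotient_edges E P \<inter> P \<times> P)\<^sup>*"
      if "(least A, z) \<in> (E \<inter> V \<times> V)\<^sup>*" for z
      using that
    proof (induction rule: rtrancl_induct)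
      case base
      then show ?case using disj[OF A] least[OF A] by blast
    next
      case (step y z)
      show ?case
      proof (intro ballI impI)
        fix C assume C: "C \<in> P" "z \<in> C"
        obtain D where D: "D \<in> P" "y \<in> D" using step.hyps P by (auto simp: partition_on_def)
        have "(A, D) \<in> (quotient_edges E P \<inter> P \<times> P)\<^sup>*" using step.IH D by blast
        moreover have "D = C \<or> (D, C) \<in> quotient_edges E P \<inter> P \<times> P"
          using step.hyps C D by (auto simp: quotient_edges_def)
        ultimately show "(A, C) \<in> (quotient_edges E P \<inter> P \<times> P)\<^sup>*"
          by (auto intro: rtrancl_into_rtrancl)
      qed
    qed
    have "(least A, least B) \<in> (E \<inter> V \<times> V)\<^sup>*"
      using conn inV A B by (auto simp: induces_connected_def)
    then show "(A, B) \<in> (quotient_edges E P \<inter> P \<times> P)\<^sup>*" using path B least by blast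
  qed
  ultimately show ?thesis by (auto simp: wellordered_connected_graph_def)
qed

end

theory Submission
  imports Defs
begin

text \<open>
  Call the \<^emph>\<open>greedy choice\<close> after a set \<open>S\<close> of visited vertices the least vertex if \<open>S\<close> is
  empty, and the least vertex of the boundary of \<open>S\<close> otherwise. In the traversal every vertex
  is the greedy choice after the set of its predecessors (\<open>greedy_choice_predecessors\<close>), and this
  determines the order of the traversal (\<open>choice_determines_predecessors\<close>). It is therefore enough
  to show that listing the parts \<open>W\<close> by the times at which their first visited elements \<open>w\<close>
  are reached makes each \<open>W\<close> the greedy choice of the quotient graph after its predecessors
  (\<open>greedy_choice_quotient\<close>).

  Since the parts are intervals, the predecessors of \<open>W\<close> together cover exactly the set \<open>U\<close>
  of vertices visited before \<open>w\<close> (\<open>Union_earlier_parts\<close>), and \<open>w\<close> is the greedy choice after \<open>U\<close>.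
  So \<open>W\<close> is adjacent to its predecessors as soon as there are any. Among all such later parts it
  has the representative that comes least in the given order of the vertices, because a later
  part \<open>W'\<close> can be adjacent to \<open>U\<close> only through its own first visited element \<open>w'\<close>: a vertex of
  \<open>W'\<close> other than \<open>w'\<close> has its first visited neighbor in \<open>W'\<close>, hence not before \<open>w'\<close>, and so has
  none in \<open>U\<close> (\<open>least_in_boundary_of_earlier\<close>). Hence \<open>w'\<close> competed with \<open>w\<close> in the original search.
\<close>

section \<open>The traversal as a greedy enumeration\<close>

definition greedy_choice :: "'a set \<Rightarrow> 'a rel \<Rightarrow> 'a rel \<Rightarrow> 'a set \<Rightarrow> 'a" where
  "greedy_choice V E r S = wo_rel.minim r (if S = {} then V else boundary V E S)"

lemma mem_search_stage_iff:
  assumes G: "wellordered_connected_graph V E r" and v: "v \<in> V"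
  shows "v \<in> search_stage V E r \<alpha> \<longleftrightarrow> entry_time V E r v \<le> \<alpha>"
proof
  show "v \<in> search_stage V E r \<alpha> \<Longrightarrow> entry_time V E r v \<le> \<alpha>"
    unfolding entry_time_def by (rule Least_le)
next
  have "v \<in> search_stage V E r (entry_time V E r v)"
    using search_exhausts[OF G v] unfolding entry_time_def by (rule LeastI_ex)
  then show "entry_time V E r v \<le> \<alpha> \<Longrightarrow> v \<in> search_stage V E r \<alpha>"
    using search_stage_mono[of "entry_time V E r v" \<alpha> V E r] by (auto dest: subsetD)
qed

text \<open>
  New vertices enter only at successor stages, and the stage before the one at which \<open>v\<close> enters is
  the set of predecessors of \<open>v\<close>.
\<close>

lemma greedy_choice_predecessors:
  assumes G: "wellordered_connected_graph V E r" and v: "v \<in> V"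
  shows "v = greedy_choice V E r {u \<in> V. entry_time V E r u < entry_time V E r v}"
proof -
  let ?S = "search_stage V E r :: 'a search_ord \<Rightarrow> 'a set"
  define \<alpha> where "\<alpha> = entry_time V E r v"
  have wo: "well_order_on V r" and ne: "V \<noteq> {}"
    using G v by (auto simp: wellordered_connected_graph_def)
  have mem: "v \<in> ?S \<beta> \<longleftrightarrow> \<alpha> \<le> \<beta>" for \<beta>
    unfolding \<alpha>_def by (rule mem_search_stage_iff[OF G v])
  show ?thesis
  proof (cases \<alpha> rule: ordinal_cases)
    case 1
    then show ?thesis using mem[of \<alpha>] by (simp add: search_stage_zero)
  next
    case (2 \<beta>)
    have before: "\<gamma> \<le> \<beta> \<longleftrightarrow> \<gamma> < \<alpha>" for \<gamma>
      using 2 by (force simp: is_succ_def not_less[symmetric])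
    have pred: "{u \<in> V. entry_time V E r u < \<alpha>} = ?S \<beta>"
      using search_stage_subset[OF wo ne, of E \<beta>] mem_search_stage_iff[OF G, of _ \<beta>]
      by (auto simp: before)
    have v_mem: "v \<in> ?S \<alpha>" "v \<notin> ?S \<beta>"
      using 2 by (auto simp: mem is_succ_def)
    have "v = greedy_choice V E r (?S \<beta>)"
    proof (cases "is_zero \<beta>")
      case True
      then show ?thesis
        using v_mem(1) by (simp add: greedy_choice_def search_stage_zero search_stage_one[OF True 2])
    next
      case False
      then have step: "v \<in> search_step V E r (?S \<beta>)"
        using v_mem(1) by (simp only: search_stage_succ[OF False 2])
      then have ne: "?S \<beta> \<noteq> {}"
        by (auto simp: search_step_def boundary_def)
      have "v = wo_rel.minim r (boundary V E (?S \<beta>))"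
        using step v_mem(2) unfolding search_step_def by (metis insertE)
      then show ?thesis unfolding greedy_choice_def if_not_P[OF ne] by this
    qed
    then show ?thesis unfolding pred[symmetric] \<alpha>_def .
  next
    case 3
    have "v \<in> ?S \<alpha>" by (simp add: mem)
    then obtain \<beta> where "\<beta> < \<alpha>" "v \<in> ?S \<beta>" by (auto simp: search_stage_limit[OF 3])
    then show ?thesis by (simp add: mem)
  qed
qed

text \<open>
  Two enumerations in which every element is obtained by the same rule \<open>N\<close> from its set of
  predecessors are equal: as long as they agree below \<open>x\<close>, the predecessors of \<open>x\<close> in the first
  are an initial segment of the second, so both continue with \<open>x\<close>.
\<close>

lemma choice_determines_predecessors:
  fixes f :: "'b \<Rightarrow> 'o::wellorder" and g :: "'b \<Rightarrow> 'p::wellorder"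
  assumes f: "\<And>x. x \<in> P \<Longrightarrow> x = N {y \<in> P. f y < f x}"
    and g: "\<And>x. x \<in> P \<Longrightarrow> x = N {y \<in> P. g y < g x}"
    and x: "x \<in> P"
  shows "{y \<in> P. f y < f x} = {y \<in> P. g y < g x}"
  using x
proof (induction "f x" arbitrary: x rule: less_induct)
  case less
  let ?I = "{y \<in> P. f y < f x}"
  have IH: "{z \<in> P. f z < f y} = {z \<in> P. g z < g y}" if "y \<in> ?I" for y
    using less.hyps that by blast
  have g_inj: "y = z" if "y \<in> P" "z \<in> P" "g y = g z" for y z
  proof -
    have "y = N {z \<in> P. g z < g y}" by (rule g[OF that(1)])
    also have "\<dots> = z" unfolding that(3) by (rule g[OF that(2), symmetric])
    finally show ?thesis .
  qed
  obtain m where m: "m \<in> P - ?I" and m_least: "\<And>y. y \<in> P - ?I \<Longrightarrow> g m \<le> g y"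
  proof -
    define c where "c = (LEAST c. c \<in> g ` (P - ?I))"
    have "g x \<in> g ` (P - ?I)" using less.prems by simp
    then have "c \<in> g ` (P - ?I)" unfolding c_def by (rule LeastI)
    then obtain m where m: "m \<in> P - ?I" and c: "c = g m" by (rule imageE)
    have "g m \<le> g y" if "y \<in> P - ?I" for y
      using that unfolding c[symmetric] c_def by (intro Least_le imageI)
    then show thesis by (rule that[OF m])
  qed
  have "g y < g m" if y: "y \<in> ?I" for y
  proof (rule ccontr)
    assume "\<not> g y < g m"
    moreover have "g m \<noteq> g y" using g_inj m y by blast
    ultimately have "m \<in> {z \<in> P. g z < g y}" using m by auto
    then have "f m < f y" using IH[OF y] by blast
    then show False using m y by auto
  qed
  then have I: "?I = {y \<in> P. g y < g m}"
    using m_least by (auto simp: not_le[symmetric])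
  have "m = N {y \<in> P. g y < g m}" using g m by blast
  also have "\<dots> = x" unfolding I[symmetric] by (rule f[OF less.prems, symmetric])
  finally show ?case using I by simp
qed

section \<open>Parts and the traversal\<close>

lemma traversal_iff:
  assumes "wellordered_connected_graph V E r"
  shows "(v, w) \<in> traversal V E r \<longleftrightarrow> v \<in> V \<and> w \<in> V \<and> entry_time V E r v \<le> entry_time V E r w"
  using entry_time_inject[OF assms] by (auto simp: traversal_def traversal_less_def order_le_less)

lemma minim_on_least:
  assumes "well_order_on V r" "A \<subseteq> V" "a \<in> A"
  shows "(wo_rel.minim r A, a) \<in> r"
  using assms wo_rel.minim_least[OF wo_relI] by (metis well_order_on_Field)

lemma minim_on_eqI:
  assumes "well_order_on V r" "A \<subseteq> V" "a \<in> A" "\<And>b. b \<in> A \<Longrightarrow> (a, b) \<in> r"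
  shows "wo_rel.minim r A = a"
  using assms wo_rel.equals_minim[OF wo_relI] by (metis well_order_on_Field)

lemma traversal_least_in:
  assumes "wellordered_connected_graph V E r" "A \<subseteq> V" "A \<noteq> {}"
  shows "traversal_least V E r A \<in> A"
  unfolding traversal_least_def using minim_on_in[OF well_order_on_traversal] assms by blast

lemma entry_time_traversal_least_le:
  assumes "wellordered_connected_graph V E r" "A \<subseteq> V" "a \<in> A"
  shows "entry_time V E r (traversal_least V E r A) \<le> entry_time V E r a"
  using minim_on_least[OF well_order_on_traversal[OF assms(1)] assms(2,3)]
  by (simp add: traversal_least_def traversal_iff[OF assms(1)])

text \<open>
  An earlier part that reached beyond the first vertex \<open>w\<close> of \<open>W\<close> would, being an interval,
  contain \<open>w\<close>.
\<close>

lemma Union_earlier_parts: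
  assumes G: "wellordered_connected_graph V E r" and P: "partition_on V P"
    and interval: "\<And>W. W \<in> P \<Longrightarrow> order_interval (traversal V E r) W"
    and W: "W \<in> P"
  defines "t \<equiv> entry_time V E r" and "l \<equiv> traversal_least V E r"
  shows "\<Union>{A \<in> P. t (l A) < t (l W)} = {u \<in> V. t u < t (l W)}"
proof -
  have part: "A \<subseteq> V" "l A \<in> A" if "A \<in> P" for A
    using that P traversal_least_in[OF G, of A] by (auto simp: partition_on_def l_def)
  have le: "t (l A) \<le> t a" if "A \<in> P" "a \<in> A" for A a
    using entry_time_traversal_least_le[OF G part(1)] that by (simp add: t_def l_def)
  have "t a < t (l W)" if A: "A \<in> P" "a \<in> A" and lt: "t (l A) < t (l W)" for A a
  proof (rule ccontr)
    assume "\<not> t a < t (l W)"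
    then have "(l A, l W) \<in> traversal V E r" "(l W, a) \<in> traversal V E r"
      using A W lt part by (auto simp: traversal_iff[OF G] t_def[symmetric])
    then have "l W \<in> A"
      using interval[OF A(1)] part(2)[OF A(1)] A(2) unfolding order_interval_def by blast
    then have "A = W"
      using P A(1) W part(2)[OF W] unfolding partition_on_def disjoint_def by blast
    then show False using lt by simp
  qed
  moreover have "\<exists>A\<in>P. t (l A) < t (l W) \<and> u \<in> A" if "u \<in> V" "t u < t (l W)" for u
    using that le P by (auto simp: partition_on_def intro: order.strict_trans1)
  ultimately show ?thesis using part(1) by blast
qed

text \<open>
  Closure under the first-neighbor function forces edges that enter a part from earlier vertices to
  end at the first visited element of the part. The bound \<open>s\<close> will be the time at
  which the search enters the part that it visits next.
\<close>

lemma least_in_boundary_of_earlier: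
  assumes G: "wellordered_connected_graph V E r" and W: "W \<subseteq> V"
    and closed: "closed_except (traversal_least_neighbor V E r) W (traversal_least V E r W)"
    and b: "b \<in> W" and ab: "(a, b) \<in> E"
  defines "t \<equiv> entry_time V E r" and "w \<equiv> traversal_least V E r W"
  assumes early: "t a < s" and late: "s \<le> t w"
  shows "w \<in> boundary V E {u \<in> V. t u < s}"
proof -
  have aV: "a \<in> V" and ba: "(b, a) \<in> E"
    using G ab by (auto simp: wellordered_connected_graph_def dest: symD)
  have "b = w"
  proof (rule ccontr)
    assume "b \<noteq> w"
    then obtain x where x: "x \<in> W" "traversal_least_neighbor V E r b = Some x"
      using closed b by (auto simp: closed_except_def w_def)
    then have "x = traversal_least V E r {u \<in> V. (b, u) \<in> E}"
      by (auto simp: traversal_least_neighbor_def split: if_splits)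
    then have "t x \<le> t a"
      using entry_time_traversal_least_le[OF G, of "{u \<in> V. (b, u) \<in> E}" a] aV ba by (auto simp: t_def)
    moreover have "t w \<le> t x"
      using entry_time_traversal_least_le[OF G W x(1)] by (simp add: t_def w_def)
    ultimately show False using early late by simp
  qed
  then show ?thesis using ab aV b W early late by (auto simp: boundary_def)
qed

section \<open>The traversal of the quotient\<close>

text \<open>
  The vertex \<open>l W\<close> was the greedy choice after the union of the earlier parts, and every part
  on the boundary of these offers its own first vertex there. So comparing parts by their first
  vertices repeats a comparison that the original search has already made.
\<close>

lemma greedy_choice_quotient:
  assumes G: "wellordered_connected_graph V E r" and P: "partition_on V P"
    and interval: "\<And>W. W \<in> P \<Longrightarrow> order_interval (traversal V E r) W"
    and closed: "\<And>W. W \<in> P \<Longrightarrow>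
      closed_except (traversal_least_neighbor V E r) W (traversal_least V E r W)"
    and W: "W \<in> P"
  defines "t \<equiv> entry_time V E r" and "l \<equiv> traversal_least V E r"
  shows "W = greedy_choice P (quotient_edges E P) (quotient_order r l P)
    {A \<in> P. t (l A) < t (l W)}"
proof -
  let ?Q = "quotient_edges E P" and ?R = "quotient_order r l P"
  let ?S = "{A \<in> P. t (l A) < t (l W)}" and ?U = "{u \<in> V. t u < t (l W)}"
  have wo: "well_order_on V r"
    using G by (auto simp: wellordered_connected_graph_def)
  have woQ: "well_order_on P ?R"
    using wellordered_connected_graph_quotient[OF G P]
    by (simp add: wellordered_connected_graph_def l_def)
  have part: "A \<subseteq> V" "l A \<in> A" "l A \<in> V" if "A \<in> P" for A
    using that P traversal_least_in[OF G, of A] by (auto simp: partition_on_def l_def)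
  have SU: "\<Union>?S = ?U"
    using Union_earlier_parts[OF G P interval W] by (simp add: t_def l_def)
  have choice: "l W = greedy_choice V E r ?U"
    unfolding t_def by (rule greedy_choice_predecessors[OF G part(3)[OF W]])
  show ?thesis
  proof (cases "?S = {}")
    case True
    have "?U = {}" by (simp only: SU[symmetric] True Union_empty)
    have "l W = wo_rel.minim r V"
      using choice unfolding greedy_choice_def if_P[OF \<open>?U = {}\<close>] by this
    then have "(W, A) \<in> ?R" if "A \<in> P" for A
      using minim_on_least[OF wo subset_refl part(3)[OF that]] W that
      by (simp add: quotient_order_def)
    then have "wo_rel.minim ?R P = W"
      by (intro minim_on_eqI[OF woQ subset_refl W])
    then show ?thesis unfolding greedy_choice_def if_P[OF True] by (rule sym)
  next
    case False
    then have "?U \<noteq> {}" using part(2) unfolding SU[symmetric] by blast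
    have lW: "l W = wo_rel.minim r (boundary V E ?U)"
      using choice unfolding greedy_choice_def if_not_P[OF \<open>?U \<noteq> {}\<close>] by this
    have sub: "boundary V E ?U \<subseteq> V" by (auto simp: boundary_def)
    have "l W \<in> boundary V E ?U"
    proof -
      obtain u where "u \<in> ?U" using \<open>?U \<noteq> {}\<close> by blast
      then have "boundary V E ?U \<noteq> {}"
        using G part(3)[OF W]
        by (intro boundary_nonempty[of E V ?U u "l W"])
          (auto simp: wellordered_connected_graph_def)
      then have "wo_rel.minim r (boundary V E ?U) \<in> boundary V E ?U"
        by (rule minim_on_in[OF wo sub])
      then show ?thesis by (simp only: lW[symmetric])
    qed
    then obtain a where "a \<in> ?U" and a: "(a, l W) \<in> E" by (auto simp: boundary_def)
    then obtain A where A: "A \<in> ?S" "a \<in> A" using SU by blast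
    then have "(A, W) \<in> ?Q"
      using W a part(2)[OF W] by (auto simp: quotient_edges_def)
    then have W_bd: "W \<in> boundary P ?Q ?S" using A(1) W by (auto simp: boundary_def)
    have "(W, B) \<in> ?R" if B: "B \<in> boundary P ?Q ?S" for B
    proof -
      have BP: "B \<in> P" and late: "t (l W) \<le> t (l B)" using B by (auto simp: boundary_def)
      obtain A' a' b where A': "A' \<in> ?S" "a' \<in> A'" and b: "b \<in> B" "(a', b) \<in> E"
        using B by (auto simp: boundary_def quotient_edges_def)
      have "t a' < t (l W)" using A' SU by blast
      then have "l B \<in> boundary V E ?U"
        using least_in_boundary_of_earlier[OF G part(1)[OF BP] closed[OF BP] b] late
        by (simp add: t_def l_def)
      then have "(wo_rel.minim r (boundary V E ?U), l B) \<in> r" by (rule minim_on_least[OF wo sub])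
      then have "(l W, l B) \<in> r" by (simp only: lW[symmetric])
      then show ?thesis using W BP by (simp add: quotient_order_def)
    qed
    then have "wo_rel.minim ?R (boundary P ?Q ?S) = W"
      using W_bd by (intro minim_on_eqI[OF woQ]) (auto simp: boundary_def)
    then show ?thesis unfolding greedy_choice_def if_not_P[OF False] by (rule sym)
  qed
qed

theorem theorem2p11:
  fixes V :: "'a set" and E r :: "'a rel" and P :: "'a set set"
  assumes "V \<noteq> {}"
    and "wellordered_connected_graph V E r"
    and "partition_on V P"
    and "\<And>W. W \<in> P \<Longrightarrow> order_interval (traversal V E r) W"
    and "\<And>W. W \<in> P \<Longrightarrow> induces_connected E W"
    and "\<And>W. W \<in> P \<Longrightarrow> closed_except (traversal_least_neighbor V E r) W (traversal_least V E r W)"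
  shows "\<forall>Wi\<in>P. \<forall>Wj\<in>P.
           traversal_less P (quotient_edges E P) (quotient_order r (traversal_least V E r) P) Wi Wj \<longleftrightarrow>
           traversal_less V E r (traversal_least V E r Wi) (traversal_least V E r Wj)"
proof (intro ballI)
  fix Wi Wj assume Wi: "Wi \<in> P" and Wj: "Wj \<in> P"
  let ?l = "traversal_least V E r" and ?t = "entry_time V E r"
  let ?Q = "quotient_edges E P" and ?R = "quotient_order r (traversal_least V E r) P"
  have inV: "?l A \<in> V" if "A \<in> P" for A
    using that assms(3) traversal_least_in[OF assms(2), of A] by (auto simp: partition_on_def)
  have "{A \<in> P. entry_time P ?Q ?R A < entry_time P ?Q ?R Wj} = {A \<in> P. ?t (?l A) < ?t (?l Wj)}"
  proof (rule choice_determines_predecessors[OF _ _ Wj])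
    fix A assume A: "A \<in> P"
    show "A = greedy_choice P ?Q ?R {B \<in> P. entry_time P ?Q ?R B < entry_time P ?Q ?R A}"
      by (rule greedy_choice_predecessors[OF wellordered_connected_graph_quotient[OF assms(2,3)] A])
    show "A = greedy_choice P ?Q ?R {B \<in> P. ?t (?l B) < ?t (?l A)}"
      by (rule greedy_choice_quotient[OF assms(2,3,4,6) A])
  qed
  then show "traversal_less P ?Q ?R Wi Wj \<longleftrightarrow> traversal_less V E r (?l Wi) (?l Wj)"
    using Wi Wj inV by (auto simp: traversal_less_def)
qed

end
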